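(* Let $P=(\varphi_n)_{n=0}^\infty$ be a fixed sequence of functions as in the context. Let $x_0=\inf\Delta^P_{c_1\ldots c_k}$ for some $P$-cylinder $\Delta^P_{c_1\ldots c_k}$ of rank $k\ge 1$, and let $(x_n)_{n=1}^\infty$ be a sequence of real numbers such that $x_0<x_n\leq 1$ for all $n\in\mathbb{N}$. Then $\lim_{n\to\infty}x_n=x_0$ if and only if there exists a number $n_0$ such that $$\begin{cases} p_i(x_n)=c_i \text{ for all } i\leq k \text{ and all } n\geq n_0,\\ \lim_{n\to\infty}p_{k+1}(x_n)=\infty.\end{cases}$$
   Context: $\mathbb{N}=\{1,2,3,\ldots\}$. Fix a sequence $P=(\varphi_n)_{n=0}^\infty$, where $\varphi_0\in\mathbb{N}$ is a constant and, for $n\ge 1$, $\varphi_n\colon\mathbb{N}^n\to\mathbb{N}$ is an arbitrary function. The $P$-representation (positive Perron expansion) of $x\in(0,1]$ is the expansion $$x=\sum_{n=0}^{\infty}\frac{r_0 r_1\cdots r_n}{(p_1-1)p_1\cdots(p_n-1)p_n\,p_{n+1}},$$ where $p_1,p_2,\ldots\in\mathbb{N}$, $r_0=\varphi_0$, $r_n=\varphi_n(p_1,\ldots,p_n)$ and $p_n\ge r_{n-1}+1$ for all $n\in\mathbb{N}$ (the $n=0$ term is $r_0/p_1$). It is known that for every such $P$ each $x\in(0,1]$ has a unique $P$-representation; the number $p_n=p_n(x)$ is called the $n$th $P$-digit of $x$. For $k\ge 1$, the $P$-cylinder of rank $k$ with base $c_1\ldots c_k$ is the set $\Delta^P_{c_1\ldots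 c_k}$ of all $x\in(0,1]$ with $p_1(x)=c_1,\ldots,p_k(x)=c_k$; here the base is admissible, i.e. $c_1\ge\varphi_0+1$ and $c_i\ge\varphi_{i-1}(c_1,\ldots,c_{i-1})+1$ for $2\le i\le k$, so that the cylinder is nonempty. It is known that each $P$-cylinder is a half-open interval of the form $(a,b]$. *)

theory Defs
  imports Complex_Main
begin

text \<open>
  The sequence \<open>P = (\<phi>\<^sub>n)\<close> is encoded as one function on lists: \<open>\<phi>\<^sub>n(p\<^sub>1,\<dots>,p\<^sub>n)\<close> is
  \<open>\<phi> [p\<^sub>1,\<dots>,p\<^sub>n]\<close>, and the constant \<open>\<phi>\<^sub>0\<close> is \<open>\<phi> []\<close>. The natural numbers of the source start
  at 1, so only the values of \<open>\<phi>\<close> on lists of positive numbers are constrained.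
\<close>

definition perron_seq :: "(nat list \<Rightarrow> nat) \<Rightarrow> bool" where
  "perron_seq \<phi> \<longleftrightarrow> (\<forall>ps. (\<forall>p\<in>set ps. p \<ge> 1) \<longrightarrow> \<phi> ps \<ge> 1)"

text \<open>Digit sequences are indexed from 0: \<open>d i\<close> is the digit \<open>p\<^sub>i\<^sub>+\<^sub>1\<close>, whereas \<open>r\<^sub>n\<close> keeps its index.\<close>

definition perron_r :: "(nat list \<Rightarrow> nat) \<Rightarrow> (nat \<Rightarrow> nat) \<Rightarrow> nat \<Rightarrow> nat" where
  "perron_r \<phi> d n = \<phi> (map d [0..<n])"

definition perron_term :: "(nat list \<Rightarrow> nat) \<Rightarrow> (nat \<Rightarrow> nat) \<Rightarrow> nat \<Rightarrow> real" where
  "perron_term \<phi> d n =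
     (\<Prod>j\<le>n. real (perron_r \<phi> d j)) /
     ((\<Prod>j<n. (real (d j) - 1) * real (d j)) * real (d n))"

definition P_representation :: "(nat list \<Rightarrow> nat) \<Rightarrow> real \<Rightarrow> (nat \<Rightarrow> nat) \<Rightarrow> bool" where
  "P_representation \<phi> x d \<longleftrightarrow>
     (\<forall>n. d n \<ge> perron_r \<phi> d n + 1) \<and> perron_term \<phi> d sums x"

text \<open>\<open>P_digit \<phi> x i\<close> is \<open>p\<^sub>i\<^sub>+\<^sub>1(x)\<close>; it is meaningful for \<open>0 < x \<le> 1\<close>, where the
  representation exists and is unique.\<close>

definition P_digit :: "(nat list \<Rightarrow> nat) \<Rightarrow> real \<Rightarrow> nat \<Rightarrow> nat" where
  "P_digit \<phi> x = (THE d. P_representation \<phi> x d)"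

text \<open>A base \<open>c\<^sub>1\<dots>c\<^sub>k\<close> is a list \<open>c\<close> of length \<open>k\<close>, so \<open>c\<^sub>i\<^sub>+\<^sub>1\<close> is \<open>c ! i\<close>.\<close>

definition P_admissible :: "(nat list \<Rightarrow> nat) \<Rightarrow> nat list \<Rightarrow> bool" where
  "P_admissible \<phi> c \<longleftrightarrow> (\<forall>i<length c. c ! i \<ge> \<phi> (take i c) + 1)"

definition P_cylinder :: "(nat list \<Rightarrow> nat) \<Rightarrow> nat list \<Rightarrow> real set" where
  "P_cylinder \<phi> c = {x. 0 < x \<and> x \<le> 1 \<and> (\<forall>i<length c. P_digit \<phi> x i = c ! i)}"

end

theory Submission
  imports Defs
begin

text \<open>
  Everything rests on peeling off the first digit. With \<open>r = \<phi> []\<close>, a representation of \<open>x\<close> with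
  first digit \<open>p\<close> is the same as a representation of some \<open>y\<close> for the shifted sequence
  \<open>ps \<mapsto> \<phi> (p # ps)\<close>, where \<open>x = r/p + r/((p - 1) p) \<cdot> y\<close>. This map of \<open>y\<close> is affine,
  increasing, and carries \<open>(0, 1]\<close> onto \<open>(r/p, r/(p - 1)]\<close>, and these intervals with \<open>p \<ge> r + 1\<close>
  partition \<open>(0, 1]\<close>. Hence the first digit of \<open>x\<close> is \<open>\<lfloor>r/x\<rfloor> + 1\<close>, which makes representations
  unique; and repeating this choice yields a representation, because the slope of each of these
  affine maps is at most \<open>1/2\<close>, so the partial sums miss \<open>x\<close> by at most \<open>2\<^sup>-\<^sup>n\<close>.

  Composing the affine maps along a base \<open>c\<close> writes the cylinder as \<open>(a, a + w]\<close>, with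
  \<open>x = a + w t\<close> for \<open>t \<in> (0, 1]\<close>, and the next digit of \<open>x\<close> is \<open>\<lfloor>\<phi> c / t\<rfloor> + 1\<close>. So, for points
  above \<open>a\<close>, convergence to \<open>a\<close> says that \<open>t \<rightarrow> 0\<close>: the points are eventually in the cylinder
  (\<open>t \<le> 1\<close>) and the next digit tends to infinity.
\<close>

section \<open>The first digit\<close>

definition branch :: "nat \<Rightarrow> nat \<Rightarrow> real \<Rightarrow> real" where
  "branch r p y = real r / real p + real r / ((real p - 1) * real p) * y"

definition unbranch :: "nat \<Rightarrow> nat \<Rightarrow> real \<Rightarrow> real" where
  "unbranch r p x = (x - real r / real p) * ((real p - 1) * real p) / real r"

definition first_digit :: "nat \<Rightarrow> real \<Rightarrow> nat" where
  "first_digit r x = nat \<lfloor>real r / x\<rfloor> + 1"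

lemma branch_unbranch:
  assumes "r \<ge> 1" "p \<ge> r + 1"
  shows "branch r p (unbranch r p x) = x"
proof -
  have "real r > 0" "real p - 1 > 0" "real p > 0" using assms by auto
  thus ?thesis unfolding branch_def unbranch_def by simp
qed

lemma first_digit_ge:
  assumes "0 < x" "x \<le> 1"
  shows "first_digit r x \<ge> r + 1"
proof -
  have "real r \<le> real r / x" using assms by (simp add: pos_le_divide_eq mult_left_le)
  hence "int r \<le> \<lfloor>real r / x\<rfloor>" by (simp add: le_floor_iff)
  thus ?thesis unfolding first_digit_def by linarith
qed

lemma first_digit_eq_iff:
  assumes "0 < x" "r \<ge> 1" "p \<ge> r + 1"
  shows "first_digit r x = p \<longleftrightarrow> real r / real p < x \<and> x \<le> real r / (real p - 1)"
proof -
  have "\<lfloor>real r / x\<rfloor> \<ge> 0" using assms by simp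
  hence "first_digit r x = p \<longleftrightarrow> \<lfloor>real r / x\<rfloor> = int p - 1"
    unfolding first_digit_def using assms by linarith
  also have "\<dots> \<longleftrightarrow> real p - 1 \<le> real r / x \<and> real r / x < real p"
    by (simp add: floor_eq_iff)
  also have "\<dots> \<longleftrightarrow> real r / real p < x \<and> x \<le> real r / (real p - 1)"
    using assms by (auto simp: field_simps)
  finally show ?thesis .
qed

text \<open>
  The endpoints match because \<open>r/p + r/((p - 1) p) = r/(p - 1)\<close>. Together with
  \<open>first_digit_eq_iff\<close>, this says that the remainder lies in \<open>(0, 1]\<close> for exactly one choice of the
  first digit.
\<close>
lemma unbranch_in_unit_iff:
  assumes "r \<ge> 1" "p \<ge> r + 1"
  shows "0 < unbranch r p x \<and> unbranch r p x \<le> 1 \<longleftrightarrow>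
         real r / real p < x \<and> x \<le> real r / (real p - 1)"
proof -
  have pos: "real r > 0" "real p - 1 > 0" "real p > 0" using assms by auto
  have "0 < unbranch r p x \<longleftrightarrow> real r / real p < x"
    using mult_pos_pos[OF pos(2,3)] pos(1)
    by (auto simp only: unbranch_def zero_less_divide_iff zero_less_mult_iff[of "x - _"])
  moreover have "unbranch r p x \<le> 1 \<longleftrightarrow> x - real r / real p \<le> real r / ((real p - 1) * real p)"
    using pos by (simp add: unbranch_def pos_divide_le_eq pos_le_divide_eq)
  moreover have "real r / real p + real r / ((real p - 1) * real p) = real r / (real p - 1)"
    using pos by (simp add: divide_simps) (simp add: algebra_simps)
  ultimately show ?thesis by linarith
qed

lemma unbranch_branch:
  assumes "r \<ge> 1" "p \<ge> r + 1"
  shows "unbranch r p (branch r p y) = y"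
proof -
  have "real r > 0" "real p - 1 > 0" "real p > 0" using assms by auto
  thus ?thesis unfolding branch_def unbranch_def by simp
qed

lemma branch_pos:
  assumes "r \<ge> 1" "p \<ge> r + 1" "0 < y"
  shows "0 < branch r p y"
  using assms unfolding branch_def by (intro add_pos_pos) auto

lemma branch_le_1:
  assumes "r \<ge> 1" "p \<ge> r + 1" "0 < y" "y \<le> 1"
  shows "branch r p y \<le> 1"
proof -
  have "branch r p y \<le> real r / (real p - 1)"
    using unbranch_in_unit_iff[OF assms(1,2), of "branch r p y"] assms
    by (simp add: unbranch_branch)
  also have "\<dots> \<le> 1" using assms by simp
  finally show ?thesis .
qed

lemma first_digit_branch:
  assumes "r \<ge> 1" "p \<ge> r + 1" "0 < y" "y \<le> 1"
  shows "first_digit r (branch r p y) = p"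
  using unbranch_in_unit_iff[OF assms(1,2), of "branch r p y"] assms
  by (simp add: unbranch_branch first_digit_eq_iff branch_pos)

lemma unbranch_first_digit:
  assumes "0 < x" "x \<le> 1" "r \<ge> 1"
  shows "0 < unbranch r (first_digit r x) x" "unbranch r (first_digit r x) x \<le> 1"
  using unbranch_in_unit_iff[OF assms(3) first_digit_ge[OF assms(1,2)], of x]
    first_digit_eq_iff[OF assms(1,3) first_digit_ge[OF assms(1,2)]] by auto

section \<open>Peeling off the first digit of a representation\<close>

abbreviation shift :: "(nat list \<Rightarrow> nat) \<Rightarrow> nat \<Rightarrow> nat list \<Rightarrow> nat" where
  "shift \<phi> p \<equiv> \<lambda>ps. \<phi> (p # ps)"

lemma perron_seq_Nil: "perron_seq \<phi> \<Longrightarrow> \<phi> [] \<ge> 1"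
  by (simp add: perron_seq_def)

lemma perron_seq_shift: "perron_seq \<phi> \<Longrightarrow> p \<ge> 1 \<Longrightarrow> perron_seq (shift \<phi> p)"
  by (simp add: perron_seq_def)

lemma perron_r_0: "perron_r \<phi> d 0 = \<phi> []"
  by (simp add: perron_r_def)

lemma perron_r_Suc: "perron_r \<phi> d (Suc n) = perron_r (shift \<phi> (d 0)) (\<lambda>i. d (Suc i)) n"
  by (simp add: perron_r_def map_upt_Suc del: upt_Suc)

lemma perron_term_0: "perron_term \<phi> d 0 = real (\<phi> []) / real (d 0)"
  by (simp add: perron_term_def perron_r_0)

lemma perron_term_Suc:
  "perron_term \<phi> d (Suc n) =
     real (\<phi> []) / ((real (d 0) - 1) * real (d 0)) *
     perron_term (shift \<phi> (d 0)) (\<lambda>i. d (Suc i)) n"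
  by (simp add: perron_term_def perron_r_0 perron_r_Suc prod.atMost_Suc_shift
      prod.lessThan_Suc_shift mult.assoc del: prod.atMost_Suc prod.lessThan_Suc)

lemma sum_perron_term_Suc:
  "(\<Sum>j<Suc n. perron_term \<phi> d j) =
     branch (\<phi> []) (d 0) (\<Sum>j<n. perron_term (shift \<phi> (d 0)) (\<lambda>i. d (Suc i)) j)"
  by (simp add: sum.lessThan_Suc_shift perron_term_0 perron_term_Suc branch_def sum_distrib_left
      del: sum.lessThan_Suc)

lemma P_representation_peel:
  assumes "perron_seq \<phi>" "P_representation \<phi> x d"
  shows "d 0 \<ge> \<phi> [] + 1"
    and "P_representation (shift \<phi> (d 0)) (unbranch (\<phi> []) (d 0) x) (\<lambda>i. d (Suc i))"
proof -
  let ?q = "real (\<phi> []) / ((real (d 0) - 1) * real (d 0))"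
  have d: "d n \<ge> perron_r \<phi> d n + 1" for n
    using assms(2) by (simp add: P_representation_def)
  show d0: "d 0 \<ge> \<phi> [] + 1" using d[of 0] by (simp add: perron_r_0)
  have pos: "real (\<phi> []) > 0" "real (d 0) - 1 > 0" "real (d 0) > 0"
    using d0 perron_seq_Nil[OF assms(1)] by auto
  have "perron_term \<phi> d sums x" using assms(2) by (simp add: P_representation_def)
  hence "(\<lambda>n. perron_term \<phi> d (Suc n)) sums (x - real (\<phi> []) / real (d 0))"
    by (subst sums_Suc_iff) (simp add: perron_term_0)
  hence "(\<lambda>n. ?q * perron_term (shift \<phi> (d 0)) (\<lambda>i. d (Suc i)) n) sums
           (?q * unbranch (\<phi> []) (d 0) x)"
    using pos by (simp add: perron_term_Suc unbranch_def)
  from sums_mult_D[OF this]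
  have "perron_term (shift \<phi> (d 0)) (\<lambda>i. d (Suc i)) sums unbranch (\<phi> []) (d 0) x"
    using pos by simp
  thus "P_representation (shift \<phi> (d 0)) (unbranch (\<phi> []) (d 0) x) (\<lambda>i. d (Suc i))"
    using d[of "Suc _"] by (simp add: P_representation_def perron_r_Suc)
qed

section \<open>Uniqueness of the representation\<close>

text \<open>
  A partial sum is a composition of branches applied to the empty sum \<open>0\<close>, and every branch maps
  \<open>[0, 1]\<close> into itself.
\<close>
lemma sum_perron_term_bounds:
  assumes "perron_seq \<phi>" "\<And>n. d n \<ge> perron_r \<phi> d n + 1"
  shows "0 \<le> (\<Sum>j<n. perron_term \<phi> d j) \<and> (\<Sum>j<n. perron_term \<phi> d j) \<le> 1"
  using assms
proof (induction n arbitrary: \<phi> d)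
  case (Suc n)
  have d0: "d 0 \<ge> \<phi> [] + 1" using Suc.prems(2)[of 0] by (simp add: perron_r_0)
  note r = perron_seq_Nil[OF Suc.prems(1)]
  let ?S = "\<Sum>j<n. perron_term (shift \<phi> (d 0)) (\<lambda>i. d (Suc i)) j"
  have "perron_seq (shift \<phi> (d 0))" using Suc.prems(1) d0 by (intro perron_seq_shift) auto
  moreover have "d (Suc n) \<ge> perron_r (shift \<phi> (d 0)) (\<lambda>i. d (Suc i)) n + 1" for n
    using Suc.prems(2)[of "Suc n"] by (simp add: perron_r_Suc)
  ultimately have S: "0 \<le> ?S" "?S \<le> 1" using Suc.IH by blast+
  have mono: "branch (\<phi> []) (d 0) ?S \<le> branch (\<phi> []) (d 0) 1"
    unfolding branch_def using S d0 by (intro add_left_mono mult_left_mono) auto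
  have "0 \<le> branch (\<phi> []) (d 0) ?S" unfolding branch_def using S d0 by auto
  thus ?case using mono branch_le_1[OF r d0, of 1] sum_perron_term_Suc[of \<phi> d n] by simp
qed auto

text \<open>
  The bounds for partial sums only give \<open>0 \<le> x\<close>. Applied to the remainder after the first digit,
  they give \<open>x \<ge> r/p > 0\<close>.
\<close>
lemma P_representation_in_unit:
  assumes "perron_seq \<phi>" "P_representation \<phi> x d"
  shows "0 < x" "x \<le> 1"
proof -
  have le: "0 \<le> x \<and> x \<le> 1" if "perron_seq \<phi>" "P_representation \<phi> x d" for \<phi> x d
  proof -
    have "(\<lambda>n. \<Sum>j<n. perron_term \<phi> d j) \<longlonglongrightarrow> x"
      using that(2) by (simp add: P_representation_def sums_def)
    moreover have "0 \<le> (\<Sum>j<n. perron_term \<phi> d j) \<and> (\<Sum>j<n. perron_term \<phi> d j) \<le> 1" for n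
      using that by (intro sum_perron_term_bounds) (auto simp: P_representation_def)
    ultimately show ?thesis by (meson LIMSEQ_le_const LIMSEQ_le_const2)
  qed
  show "x \<le> 1" using le[OF assms] by simp
  note peel = P_representation_peel[OF assms]
  note r = perron_seq_Nil[OF assms(1)]
  have "0 \<le> unbranch (\<phi> []) (d 0) x"
    using le[OF _ peel(2)] perron_seq_shift[OF assms(1), of "d 0"] peel(1) by auto
  hence "0 < branch (\<phi> []) (d 0) (unbranch (\<phi> []) (d 0) x)"
    unfolding branch_def using r peel(1) by (intro add_pos_nonneg) auto
  thus "0 < x" using branch_unbranch[OF r peel(1)] by simp
qed

text \<open>
  The remainder after the first digit is again in \<open>(0, 1]\<close>, and this forces the first digit.
\<close>
lemma P_representation_first_digit:
  assumes "perron_seq \<phi>" "P_representation \<phi> x d"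
  shows "d 0 = first_digit (\<phi> []) x"
proof -
  note peel = P_representation_peel[OF assms]
  note r = perron_seq_Nil[OF assms(1)]
  have "perron_seq (shift \<phi> (d 0))" using assms(1) peel(1) by (intro perron_seq_shift) auto
  note y = P_representation_in_unit[OF this peel(2)]
  show ?thesis
    using first_digit_branch[OF r peel(1) y] branch_unbranch[OF r peel(1)] by simp
qed

lemma P_representation_unique:
  assumes "perron_seq \<phi>" "P_representation \<phi> x d" "P_representation \<phi> x e"
  shows "d = e"
proof -
  have "d n = e n" for n
    using assms
  proof (induction n arbitrary: \<phi> x d e)
    case 0
    thus ?case using P_representation_first_digit by metis
  next
    case (Suc n)
    have eq: "e 0 = d 0" using P_representation_first_digit Suc.prems by metis
    note d = P_representation_peel[OF Suc.prems(1,2)]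
    note e = P_representation_peel(2)[OF Suc.prems(1,3), unfolded eq]
    have "perron_seq (shift \<phi> (d 0))" using Suc.prems(1) d(1) by (intro perron_seq_shift) auto
    from Suc.IH[OF this d(2) e] show ?case .
  qed
  thus ?thesis by auto
qed

section \<open>Existence of the representation\<close>

primrec greedy_digit :: "nat \<Rightarrow> (nat list \<Rightarrow> nat) \<Rightarrow> real \<Rightarrow> nat" where
  "greedy_digit 0 \<phi> x = first_digit (\<phi> []) x"
| "greedy_digit (Suc n) \<phi> x =
     greedy_digit n (shift \<phi> (first_digit (\<phi> []) x)) (unbranch (\<phi> []) (first_digit (\<phi> []) x) x)"

lemma greedy_digit_ge:
  assumes "perron_seq \<phi>" "0 < x" "x \<le> 1"
  shows "greedy_digit n \<phi> x \<ge> perron_r \<phi> (\<lambda>i. greedy_digit i \<phi> x) n + 1"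
  using assms
proof (induction n arbitrary: \<phi> x)
  case 0
  thus ?case using first_digit_ge[of x "\<phi> []"] by (simp add: perron_r_0)
next
  case (Suc n)
  let ?p = "first_digit (\<phi> []) x"
  have "perron_seq (shift \<phi> ?p)"
    using Suc.prems(1) by (intro perron_seq_shift) (auto simp: first_digit_def)
  with Suc.IH unbranch_first_digit[OF Suc.prems(2,3) perron_seq_Nil[OF Suc.prems(1)]]
  show ?case by (simp add: perron_r_Suc)
qed

text \<open>
  Removing the first digit divides the error by the slope \<open>r/((p - 1) p)\<close> of the branch, and this
  slope is at most \<open>1/2\<close>, because \<open>p \<ge> r + 1 \<ge> 2\<close>.
\<close>
lemma greedy_remainder_bounds:
  assumes "perron_seq \<phi>" "0 < x" "x \<le> 1"
  shows "0 < x - (\<Sum>j<n. perron_term \<phi> (\<lambda>i. greedy_digit i \<phi> x) j) \<and>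
         x - (\<Sum>j<n. perron_term \<phi> (\<lambda>i. greedy_digit i \<phi> x) j) \<le> (1/2) ^ n"
  using assms
proof (induction n arbitrary: \<phi> x)
  case (Suc n)
  let ?r = "\<phi> []" and ?p = "first_digit (\<phi> []) x"
  let ?y = "unbranch ?r ?p x" and ?q = "real ?r / ((real ?p - 1) * real ?p)"
  let ?S = "\<Sum>j<n. perron_term (shift \<phi> ?p) (\<lambda>i. greedy_digit i (shift \<phi> ?p) ?y) j"
  note r = perron_seq_Nil[OF Suc.prems(1)]
  have p: "?p \<ge> ?r + 1" using first_digit_ge Suc.prems by auto
  have "perron_seq (shift \<phi> ?p)" using Suc.prems(1) p by (intro perron_seq_shift) auto
  with Suc.IH unbranch_first_digit[OF Suc.prems(2,3) r]
  have IH: "0 < ?y - ?S" "?y - ?S \<le> (1/2) ^ n" by blast+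
  have "x = branch ?r ?p ?y" using branch_unbranch[OF r p] by simp
  hence *: "x - (\<Sum>j<Suc n. perron_term \<phi> (\<lambda>i. greedy_digit i \<phi> x) j) = ?q * (?y - ?S)"
    using sum_perron_term_Suc[of \<phi> "\<lambda>i. greedy_digit i \<phi> x" n]
    by (simp add: branch_def algebra_simps del: sum.lessThan_Suc)
  have q: "0 < ?q" using r p by (auto intro!: divide_pos_pos mult_pos_pos)
  have "real ?r * 2 \<le> (real ?p - 1) * real ?p" using r p by (intro mult_mono) auto
  hence "?q \<le> 1/2" using r p by (subst pos_divide_le_eq) auto
  hence "?q * (?y - ?S) \<le> 1/2 * (1/2) ^ n" using IH q by (intro mult_mono) auto
  with mult_pos_pos[OF q IH(1)] show ?case unfolding * power_Suc by blast
qed auto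

lemma P_representation_greedy:
  assumes "perron_seq \<phi>" "0 < x" "x \<le> 1"
  shows "P_representation \<phi> x (\<lambda>i. greedy_digit i \<phi> x)"
proof -
  let ?S = "\<lambda>n. \<Sum>j<n. perron_term \<phi> (\<lambda>i. greedy_digit i \<phi> x) j"
  have "(\<lambda>n. x - ?S n) \<longlonglongrightarrow> 0"
  proof (rule real_tendsto_sandwich[where f = "\<lambda>_. 0" and h = "\<lambda>n. (1/2) ^ n"])
    show "(\<lambda>n. (1/2::real) ^ n) \<longlonglongrightarrow> 0" by (intro LIMSEQ_power_zero) auto
    show "\<forall>\<^sub>F n in sequentially. x - ?S n \<le> (1/2) ^ n"
      and "\<forall>\<^sub>F n in sequentially. 0 \<le> x - ?S n"
      using greedy_remainder_bounds[OF assms] by (auto intro!: always_eventually less_imp_le)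
  qed auto
  from tendsto_diff[OF tendsto_const[of x] this] have "?S \<longlonglongrightarrow> x" by simp
  thus ?thesis using greedy_digit_ge[OF assms] by (simp add: P_representation_def sums_def)
qed

lemma P_digit_eq_greedy:
  assumes "perron_seq \<phi>" "0 < x" "x \<le> 1"
  shows "P_digit \<phi> x n = greedy_digit n \<phi> x"
proof -
  have "P_digit \<phi> x = (\<lambda>i. greedy_digit i \<phi> x)"
    unfolding P_digit_def
    using P_representation_greedy[OF assms] P_representation_unique[OF assms(1)]
    by (intro the_equality) auto
  thus ?thesis by simp
qed

lemma P_digit_0:
  assumes "perron_seq \<phi>" "0 < x" "x \<le> 1"
  shows "P_digit \<phi> x 0 = first_digit (\<phi> []) x"
  using P_digit_eq_greedy[OF assms] by simp

text \<open>
  Prepending \<open>p\<close> to the digits of \<open>y\<close> is the map \<open>branch\<close>; along it every statement about digits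
  is reduced to a shorter base.
\<close>
lemma P_digit_branch:
  assumes "perron_seq \<phi>" "p \<ge> \<phi> [] + 1" "0 < y" "y \<le> 1"
  shows "P_digit \<phi> (branch (\<phi> []) p y) 0 = p"
    and "P_digit \<phi> (branch (\<phi> []) p y) (Suc n) = P_digit (shift \<phi> p) y n"
proof -
  note r = perron_seq_Nil[OF assms(1)]
  have "perron_seq (shift \<phi> p)" using assms by (intro perron_seq_shift) auto
  note P_digit_eq_greedy[OF this assms(3,4)]
    P_digit_eq_greedy[OF assms(1) branch_pos[OF r assms(2,3)] branch_le_1[OF r assms(2-4)]]
  thus "P_digit \<phi> (branch (\<phi> []) p y) 0 = p"
    and "P_digit \<phi> (branch (\<phi> []) p y) (Suc n) = P_digit (shift \<phi> p) y n"
    using first_digit_branch[OF r assms(2-4)] by (auto simp: unbranch_branch[OF r assms(2)])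
qed

section \<open>Cylinders\<close>

lemma P_cylinder_Cons:
  assumes "perron_seq \<phi>" "p \<ge> \<phi> [] + 1"
  shows "P_cylinder \<phi> (p # c) = branch (\<phi> []) p ` P_cylinder (shift \<phi> p) c"
proof (intro equalityI subsetI)
  note r = perron_seq_Nil[OF assms(1)]
  fix x assume x: "x \<in> P_cylinder \<phi> (p # c)"
  hence unit: "0 < x" "x \<le> 1" and digits: "\<And>i. i < Suc (length c) \<Longrightarrow> P_digit \<phi> x i = (p # c) ! i"
    by (auto simp: P_cylinder_def)
  let ?y = "unbranch (\<phi> []) p x"
  have "first_digit (\<phi> []) x = p" using digits[of 0] P_digit_0[OF assms(1) unit] by simp
  hence y: "0 < ?y" "?y \<le> 1" using unbranch_first_digit[OF unit r] by auto
  have x_eq: "branch (\<phi> []) p ?y = x" using branch_unbranch[OF r assms(2)] .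
  have "P_digit (shift \<phi> p) ?y i = c ! i" if "i < length c" for i
    using digits[of "Suc i"] P_digit_branch(2)[OF assms y, of i] that by (simp add: x_eq)
  hence "?y \<in> P_cylinder (shift \<phi> p) c" using y by (simp add: P_cylinder_def)
  thus "x \<in> branch (\<phi> []) p ` P_cylinder (shift \<phi> p) c" using x_eq by (metis image_eqI)
next
  note r = perron_seq_Nil[OF assms(1)]
  fix x assume "x \<in> branch (\<phi> []) p ` P_cylinder (shift \<phi> p) c"
  then obtain y where y: "x = branch (\<phi> []) p y" "0 < y" "y \<le> 1"
    "\<And>i. i < length c \<Longrightarrow> P_digit (shift \<phi> p) y i = c ! i"
    by (auto simp: P_cylinder_def)
  have "P_digit \<phi> x i = (p # c) ! i" if "i < length (p # c)" for i
    using that y P_digit_branch[OF assms y(2,3)] by (cases i) auto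
  thus "x \<in> P_cylinder \<phi> (p # c)"
    using branch_pos[OF r assms(2) y(2)] branch_le_1[OF r assms(2) y(2,3)] y(1)
    by (simp add: P_cylinder_def)
qed

lemma P_admissible_Cons:
  "P_admissible \<phi> (p # c) \<longleftrightarrow> p \<ge> \<phi> [] + 1 \<and> P_admissible (shift \<phi> p) c"
  by (auto simp: P_admissible_def All_less_Suc2)

text \<open>
  The map \<open>t \<mapsto> a + w t\<close> is the composition of the branches along the base. The coordinate \<open>t\<close> is
  then the remainder of \<open>x\<close> after the digits \<open>c\<close>, so the next digit of \<open>x\<close> is the first digit
  of \<open>t\<close>.
\<close>
lemma P_cylinder_affine:
  assumes "perron_seq \<phi>" "P_admissible \<phi> c"
  obtains a w where "0 < w" "P_cylinder \<phi> c = {a<..a + w}"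
    "\<And>t. 0 < t \<Longrightarrow> t \<le> 1 \<Longrightarrow> P_digit \<phi> (a + w * t) (length c) = first_digit (\<phi> c) t"
  using assms
proof (induction c arbitrary: \<phi> thesis)
  case Nil
  show ?case
    by (rule Nil(1)[of 1 0]) (auto simp: P_cylinder_def P_digit_0[OF Nil(2)])
next
  case (Cons p c)
  let ?r = "real (\<phi> [])"
  have p: "p \<ge> \<phi> [] + 1" and adm: "P_admissible (shift \<phi> p) c"
    using Cons.prems(3) by (simp_all add: P_admissible_Cons)
  note r = perron_seq_Nil[OF Cons.prems(2)]
  have "perron_seq (shift \<phi> p)" using Cons.prems(2) p by (intro perron_seq_shift) auto
  with Cons.IH adm obtain a w where w: "0 < w"
    and cyl: "P_cylinder (shift \<phi> p) c = {a<..a + w}"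
    and digit: "\<And>t. 0 < t \<Longrightarrow> t \<le> 1 \<Longrightarrow>
      P_digit (shift \<phi> p) (a + w * t) (length c) = first_digit (\<phi> (p # c)) t"
    by blast
  define q where "q = ?r / ((real p - 1) * real p)"
  have q: "q > 0" unfolding q_def using r p by (auto intro!: divide_pos_pos mult_pos_pos)
  have br: "branch (\<phi> []) p y = q * y + ?r / real p" for y by (simp add: branch_def q_def)
  show ?case
  proof (rule Cons.prems(1))
    show "0 < q * w" using q w by simp
    have "P_cylinder \<phi> (p # c) = (\<lambda>y. q * y + ?r / real p) ` {a<..a + w}"
      using P_cylinder_Cons[OF Cons.prems(2) p, of c] unfolding cyl br .
    also have "\<dots> = {branch (\<phi> []) p a<..branch (\<phi> []) p a + q * w}"
    proof (intro equalityI subsetI)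
      fix x assume "x \<in> {branch (\<phi> []) p a<..branch (\<phi> []) p a + q * w}"
      hence "(x - ?r / real p) / q \<in> {a<..a + w}"
        using q by (auto simp: br field_simps)
      moreover have "x = q * ((x - ?r / real p) / q) + ?r / real p" using q by simp
      ultimately show "x \<in> (\<lambda>y. q * y + ?r / real p) ` {a<..a + w}" by blast
    next
      fix x assume "x \<in> (\<lambda>y. q * y + ?r / real p) ` {a<..a + w}"
      then obtain y where y: "x = q * y + ?r / real p" "a < y" "y \<le> a + w"
        by (auto simp only: image_iff greaterThanAtMost_iff)
      have "q * a < q * y" "q * y \<le> q * (a + w)" using y q by auto
      thus "x \<in> {branch (\<phi> []) p a<..branch (\<phi> []) p a + q * w}"
        unfolding br y(1) by (simp add: algebra_simps)
    qed
    finally show "P_cylinder \<phi> (p # c) = {branch (\<phi> []) p a<..branch (\<phi> []) p a + q * w}" .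
    fix t :: real assume t: "0 < t" "t \<le> 1"
    have "a + w * t \<in> P_cylinder (shift \<phi> p) c" unfolding cyl using w t by simp
    hence y: "0 < a + w * t" "a + w * t \<le> 1" by (auto simp: P_cylinder_def)
    have "branch (\<phi> []) p a + q * w * t = branch (\<phi> []) p (a + w * t)"
      by (simp add: br algebra_simps)
    thus "P_digit \<phi> (branch (\<phi> []) p a + q * w * t) (length (p # c)) = first_digit (\<phi> (p # c)) t"
      using P_digit_branch(2)[OF Cons.prems(2) p y, of "length c"] digit[OF t] by simp
  qed
qed

section \<open>Convergence to the left endpoint of a cylinder\<close>

text \<open>
  The two sides are reciprocal up to the factor \<open>r\<close>: \<open>r/t < p \<le> r/t + 1\<close> for the first digit
  \<open>p\<close> of \<open>t\<close>.
\<close>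
lemma first_digit_at_top_iff:
  assumes "r \<ge> 1" "\<forall>\<^sub>F n in F. 0 < t n"
  shows "filterlim (\<lambda>n. first_digit r (t n)) at_top F \<longleftrightarrow> (t \<longlongrightarrow> 0) F"
proof
  assume "(t \<longlongrightarrow> 0) F"
  hence "filterlim t (at_right 0) F"
    using assms(2) by (auto simp: filterlim_at elim: eventually_mono)
  hence lim: "filterlim (\<lambda>n. real r * inverse (t n)) at_top F"
    using assms(1) by (intro filterlim_tendsto_pos_mult_at_top[OF tendsto_const]
        filterlim_compose[OF filterlim_inverse_at_top_right]) auto
  have "filterlim (\<lambda>n. real (first_digit r (t n))) at_top F"
    using lim
  proof (rule filterlim_at_top_mono)
    show "\<forall>\<^sub>F n in F. real r * inverse (t n) \<le> real (first_digit r (t n))"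
      using assms(2)
    proof eventually_elim
      case (elim n)
      thus ?case by (simp add: first_digit_def divide_inverse[symmetric]) linarith
    qed
  qed
  thus "filterlim (\<lambda>n. first_digit r (t n)) at_top F" by (simp add: filterlim_sequentially_iff_filterlim_real)
next
  assume "filterlim (\<lambda>n. first_digit r (t n)) at_top F"
  hence "filterlim (\<lambda>n. real (first_digit r (t n))) at_top F"
    by (simp add: filterlim_sequentially_iff_filterlim_real)
  hence "filterlim (\<lambda>n. real (first_digit r (t n)) + (-1)) at_top F"
    by (subst add.commute) (rule filterlim_tendsto_add_at_top[OF tendsto_const])
  moreover have "\<forall>\<^sub>F n in F. real (first_digit r (t n)) + (-1) \<le> real r / t n"
    using assms(2) by eventually_elim (simp add: first_digit_def)
  ultimately have "filterlim (\<lambda>n. real r / t n) at_top F" by (rule filterlim_at_top_mono)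
  hence "((\<lambda>n. real r / (real r / t n)) \<longlongrightarrow> 0) F"
    by (intro tendsto_divide_0[OF tendsto_const] filterlim_at_top_imp_at_infinity)
  thus "(t \<longlongrightarrow> 0) F" using assms(1) by simp
qed

theorem proposition4:
  fixes \<phi> :: "nat list \<Rightarrow> nat" and c :: "nat list" and k :: nat
    and x0 :: real and x :: "nat \<Rightarrow> real"
  assumes "perron_seq \<phi>"
    and "k \<ge> 1" and "length c = k" and "P_admissible \<phi> c"
    and "x0 = Inf (P_cylinder \<phi> c)"
    and "\<And>n. n \<ge> 1 \<Longrightarrow> x0 < x n \<and> x n \<le> 1"
  shows "x \<longlonglongrightarrow> x0 \<longleftrightarrow>
    (\<exists>n0\<ge>1. (\<forall>n\<ge>n0. \<forall>i<k. P_digit \<phi> (x n) i = c ! i) \<and>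
            filterlim (\<lambda>n. P_digit \<phi> (x n) k) at_top sequentially)"
proof -
  obtain a w where w: "0 < w" and cyl: "P_cylinder \<phi> c = {a<..a + w}"
    and digit: "\<And>t. 0 < t \<Longrightarrow> t \<le> 1 \<Longrightarrow> P_digit \<phi> (a + w * t) (length c) = first_digit (\<phi> c) t"
    by (rule P_cylinder_affine[OF assms(1,4)], rule that)
  have x0: "x0 = a" using w by (simp add: assms(5) cyl)
  have r: "\<phi> c \<ge> 1"
  proof -
    have "\<forall>p\<in>set c. p \<ge> 1" using assms(4) by (fastforce simp: P_admissible_def in_set_conv_nth)
    thus ?thesis using assms(1) by (simp add: perron_seq_def)
  qed
  \<comment> \<open>Digits mean something only in \<open>(0, 1]\<close>; \<open>a \<ge> 0\<close> places every \<open>x n\<close> with \<open>n \<ge> 1\<close> there.\<close>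
  have a: "0 \<le> a"
  proof (rule ccontr)
    assume "\<not> 0 \<le> a"
    hence "a + min w (-a) \<in> P_cylinder \<phi> c" using w by (simp add: cyl)
    hence "0 < a + min w (-a)" by (simp add: P_cylinder_def)
    thus False by (simp add: min_def split: if_splits)
  qed
  \<comment> \<open>The value \<open>x 0\<close> is arbitrary, so the sign of \<open>t\<close> is known only from index 1 on.\<close>
  define t where "t n = (x n - a) / w" for n
  have x_eq: "x n = a + w * t n" for n using w by (simp add: t_def)
  have t_pos: "0 < t n" if "n \<ge> 1" for n using assms(6)[OF that] w by (simp add: t_def x0)
  hence ev_pos: "\<forall>\<^sub>F n in sequentially. 0 < t n" by (auto simp: eventually_sequentially)
  have t_lim: "x \<longlonglongrightarrow> x0 \<longleftrightarrow> t \<longlonglongrightarrow> 0"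
  proof
    assume "x \<longlonglongrightarrow> x0"
    hence "(\<lambda>n. (x n - a) / w) \<longlonglongrightarrow> (x0 - a) / w" by (intro tendsto_intros) (use w in auto)
    thus "t \<longlonglongrightarrow> 0" unfolding t_def by (simp add: x0)
  next
    assume "t \<longlonglongrightarrow> 0"
    hence "(\<lambda>n. a + w * t n) \<longlonglongrightarrow> a + w * 0" by (intro tendsto_intros)
    thus "x \<longlonglongrightarrow> x0" by (simp add: x_eq[symmetric] x0)
  qed
  have in_cyl: "(\<forall>i<k. P_digit \<phi> (x n) i = c ! i) \<longleftrightarrow> t n \<le> 1" if "n \<ge> 1" for n
  proof -
    have "(\<forall>i<k. P_digit \<phi> (x n) i = c ! i) \<longleftrightarrow> x n \<in> P_cylinder \<phi> c"
      using assms(6)[OF that] a x0 assms(3) by (auto simp: P_cylinder_def)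
    also have "\<dots> \<longleftrightarrow> t n \<le> 1" using assms(6)[OF that] w by (simp add: cyl x0 t_def field_simps)
    finally show ?thesis .
  qed
  have digit_lim: "filterlim (\<lambda>n. P_digit \<phi> (x n) k) at_top sequentially \<longleftrightarrow> t \<longlonglongrightarrow> 0"
    if "\<forall>\<^sub>F n in sequentially. t n \<le> 1"
  proof -
    have "\<forall>\<^sub>F n in sequentially. P_digit \<phi> (x n) k = first_digit (\<phi> c) (t n)"
      using that ev_pos by eventually_elim (simp add: x_eq digit assms(3)[symmetric])
    hence "filterlim (\<lambda>n. P_digit \<phi> (x n) k) at_top sequentially \<longleftrightarrow>
           filterlim (\<lambda>n. first_digit (\<phi> c) (t n)) at_top sequentially"
      by (intro filterlim_cong refl)
    thus ?thesis using first_digit_at_top_iff[OF r ev_pos] by simp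
  qed
  show ?thesis
  proof
    assume "x \<longlonglongrightarrow> x0"
    hence t0: "t \<longlonglongrightarrow> 0" using t_lim by simp
    hence ev: "\<forall>\<^sub>F n in sequentially. t n \<le> 1"
      using order_tendstoD(2)[OF t0, of 1] by (auto elim: eventually_mono)
    then obtain N where "\<And>n. n \<ge> N \<Longrightarrow> t n \<le> 1" by (auto simp: eventually_sequentially)
    hence "\<forall>n\<ge>max 1 N. \<forall>i<k. P_digit \<phi> (x n) i = c ! i" using in_cyl by simp
    moreover have "filterlim (\<lambda>n. P_digit \<phi> (x n) k) at_top sequentially"
      using digit_lim[OF ev] t0 by simp
    ultimately show "\<exists>n0\<ge>1. (\<forall>n\<ge>n0. \<forall>i<k. P_digit \<phi> (x n) i = c ! i) \<and>
        filterlim (\<lambda>n. P_digit \<phi> (x n) k) at_top sequentially"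
      by (intro exI[of _ "max 1 N"]) auto
  next
    assume "\<exists>n0\<ge>1. (\<forall>n\<ge>n0. \<forall>i<k. P_digit \<phi> (x n) i = c ! i) \<and>
        filterlim (\<lambda>n. P_digit \<phi> (x n) k) at_top sequentially"
    then obtain n0 where "n0 \<ge> 1" "\<forall>n\<ge>n0. \<forall>i<k. P_digit \<phi> (x n) i = c ! i"
      and lim: "filterlim (\<lambda>n. P_digit \<phi> (x n) k) at_top sequentially" by blast
    hence "\<forall>n\<ge>n0. t n \<le> 1" using in_cyl by auto
    hence "\<forall>\<^sub>F n in sequentially. t n \<le> 1" by (auto simp: eventually_sequentially)
    thus "x \<longlonglongrightarrow> x0" using digit_lim lim t_lim by simp
  qed
qed

end
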